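(* Let $n\ge 1$ be an integer, let $1<\alpha<2$, and let $V(t,q)=-\frac{1}{2}|q|^2+a(t)|q|^{\alpha}$ for $t\in\mathbb{R}$, $q\in\mathbb{R}^n$, where $a$ satisfies: (i) $a\in C^0(\mathbb{R},\mathbb{R}^+)$; (ii) $a\in L^1(\mathbb{R})\cap L^2(\mathbb{R})$. Then the second order Hamiltonian system $$\ddot{q}(t)+V_q(t,q(t))=0,\qquad t\in\mathbb{R},$$ has at least one non-zero homoclinic orbit $q:\mathbb{R}\to\mathbb{R}^n$ with $q(\pm\infty)=0$ and $\dot q(\pm\infty)=0$.
   Context: $\mathbb{R}^+=(0,+\infty)$, $|\cdot|$ is the Euclidean norm on $\mathbb{R}^n$, and $V_q(t,q)$ denotes the gradient of $V$ with respect to $q$, so that here $V_q(t,q)=-q+\alpha a(t)|q|^{\alpha-2}q$, with $|q|^{\alpha-2}q$ understood as $0$ at $q=0$. A homoclinic orbit (emanating from zero) is a classical ($C^2$) solution $q:\mathbb{R}\to\mathbb{R}^n$ of the system which tends to $0$ at both ends of time; $q(\pm\infty)=0$ and $\dot q(\pm\infty)=0$ mean $q(t)\to 0$ and $\dot q(t)\to 0$ as $t\to+\infty$ and as $t\to-\infty$. Non-zero means $q$ is not identically zero. *)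

theory Defs
  imports "HOL-Analysis.Analysis"
begin

text \<open>
  Classical (\<open>C\<^sup>2\<close>) solutions on the whole line of \<open>q'' + V\<^sub>q (t, q) = 0\<close>, where \<open>V\<^sub>q\<close> is the gradient
  in the space variable.  The gradient is used relationally, so being a solution includes that
  \<open>V t\<close> is differentiable along the orbit.
\<close>

definition hamiltonian_solution :: "(real \<Rightarrow> 'a::real_inner \<Rightarrow> real) \<Rightarrow> (real \<Rightarrow> 'a) \<Rightarrow> bool"
  where "hamiltonian_solution V q \<longleftrightarrow>
    q C1_differentiable_on UNIV \<and>
    (\<lambda>t. vector_derivative q (at t)) C1_differentiable_on UNIV \<and>
    (\<forall>t. \<exists>Vq. GDERIV (V t) (q t) :> Vq \<and>
       vector_derivative (\<lambda>s. vector_derivative q (at s)) (at t) + Vq = 0)"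

definition homoclinic_orbit :: "(real \<Rightarrow> 'a::real_inner \<Rightarrow> real) \<Rightarrow> (real \<Rightarrow> 'a) \<Rightarrow> bool"
  where "homoclinic_orbit V q \<longleftrightarrow>
    hamiltonian_solution V q \<and> (q \<longlongrightarrow> 0) at_top \<and> (q \<longlongrightarrow> 0) at_bot"

text \<open>Since \<open>0 powr \<alpha> = 0\<close>, the formula below is also the intended one at \<open>q = 0\<close>.\<close>

definition potential :: "real \<Rightarrow> (real \<Rightarrow> real) \<Rightarrow> real \<Rightarrow> 'a::real_inner \<Rightarrow> real"
  where "potential \<alpha> a t q = - (1/2) * (norm q)\<^sup>2 + a t * norm q powr \<alpha>"

lemma GDERIV_norm_powr:
  fixes q :: "'a::real_inner"
  assumes "1 < \<alpha>"
  shows "GDERIV (\<lambda>x. norm x powr \<alpha>) q :> (\<alpha> * norm q powr (\<alpha> - 2)) *\<^sub>R q"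
proof (cases "q = 0")
  case False
  then have n: "GDERIV norm q :> sgn q"
    by (rule GDERIV_norm)
  have d: "DERIV (\<lambda>r. r powr \<alpha>) (norm q) :> \<alpha> * norm q powr (\<alpha> - 1)"
    using False by (auto intro!: has_real_derivative_powr)
  have e: "norm q powr (\<alpha> - 1) = norm q powr (\<alpha> - 2) * norm q"
    using False by (simp add: powr_mult_base[symmetric] mult.commute powr_mult_base)
  show ?thesis
    by (rule GDERIV_subst[OF GDERIV_DERIV_compose[OF n d]]) (use False in \<open>simp add: e sgn_div_norm\<close>)
next
  case True
  have "((\<lambda>h::'a. norm h powr (\<alpha> - 1)) \<longlongrightarrow> 0 powr (\<alpha> - 1)) (at 0)"
    using assms by (intro tendsto_powr' tendsto_norm_zero tendsto_const tendsto_ident_at) auto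
  then have "((\<lambda>h::'a. norm h powr (\<alpha> - 1)) \<longlongrightarrow> 0) (at 0)"
    by simp
  moreover have "norm h powr \<alpha> / norm h = norm h powr (\<alpha> - 1)" for h :: 'a
    by (cases "h = 0") (simp_all add: powr_diff)
  ultimately show ?thesis
    unfolding True gderiv_def by (simp add: has_derivative_at)
qed

lemma GDERIV_potential:
  fixes q :: "'a::real_inner"
  assumes "1 < \<alpha>"
  shows "GDERIV (potential \<alpha> a t) q :> - q + (\<alpha> * a t * norm q powr (\<alpha> - 2)) *\<^sub>R q"
proof -
  have "((\<lambda>x. - (1/2) * (x \<bullet> x) + a t * norm x powr \<alpha>) has_derivative
      (\<lambda>h. h \<bullet> (- q + (\<alpha> * a t * norm q powr (\<alpha> - 2)) *\<^sub>R q))) (at q)"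
    by (rule derivative_eq_intros GDERIV_norm_powr[OF assms, unfolded gderiv_def] refl | simp)+
       (auto simp: fun_eq_iff inner_simps inner_commute algebra_simps)
  then show ?thesis
    unfolding gderiv_def potential_def[abs_def] power2_norm_eq_inner .
qed

end

theory Submission
  imports Defs
begin

text \<open>
  On a ray \<open>q t = u t *\<^sub>R e\<close> with \<open>norm e = 1\<close> and \<open>u > 0\<close> the system reduces to the scalar equation
  \<open>u'' = u - \<alpha> a u powr (\<alpha> - 1)\<close>.  The Green kernel \<open>exp (-\<bar>t\<bar>) / 2\<close> of \<open>1 - d\<^sup>2/dt\<^sup>2\<close> turns
  it into a fixed point equation for a monotone operator, and since \<open>0 < \<alpha> - 1 < 1\<close> a large
  constant is a supersolution and a small multiple of \<open>exp (-\<bar>t\<bar>)\<close> is a subsolution.  Iterating from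
  the supersolution gives a decreasing sequence whose limit is a fixed point lying above
  the subsolution, hence positive.
\<close>

section \<open>The Green operator: order, bounds and limits\<close>

definition green :: "(real \<Rightarrow> real) \<Rightarrow> real \<Rightarrow> real"
  where "green f t = (LINT s|lborel. exp (- \<bar>t - s\<bar>) / 2 * f s)"

lemma integrable_green_kernel:
  fixes f :: "real \<Rightarrow> real"
  assumes "integrable lborel f"
  shows "integrable lborel (\<lambda>s. exp (- \<bar>t - s\<bar>) / 2 * f s)"
proof (rule Bochner_Integration.integrable_bound[OF assms])
  have "norm (exp (- \<bar>t - s\<bar>) / 2 * f s) \<le> 1 * norm (f s)" for s
    unfolding norm_mult by (intro mult_right_mono) (auto intro: order_trans[of _ 1])
  then show "AE s in lborel. norm (exp (- \<bar>t - s\<bar>) / 2 * f s) \<le> norm (f s)"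
    by simp
qed (use assms in measurable)

lemma green_mono:
  assumes "integrable lborel f" "integrable lborel g" "\<And>s. f s \<le> g s"
  shows "green f t \<le> green g t"
  unfolding green_def
  by (intro Bochner_Integration.integral_mono integrable_green_kernel assms mult_left_mono) simp

lemma green_nonneg:
  assumes "\<And>s. 0 \<le> f s"
  shows "0 \<le> green f t"
  unfolding green_def using assms by (intro Bochner_Integration.integral_nonneg) auto

lemma green_le_integral:
  assumes "integrable lborel f" "\<And>s. 0 \<le> f s"
  shows "green f t \<le> (LINT s|lborel. f s) / 2"
proof -
  have "green f t \<le> (LINT s|lborel. 1 / 2 * f s)"
    unfolding green_def
    by (intro Bochner_Integration.integral_mono integrable_green_kernel assms mult_right_mono integrable_mult_right) simp_all
  then show ?thesis by simp
qed

text \<open>The triangle inequality for \<open>t - s\<close> gives exp (-\<bar>t\<bar>) * exp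
  (-\<bar>s\<bar>) \<le> exp (-\<bar>t - s\<bar>), and the factor in \<open>t\<close> leaves the
  integral. This Harnack-type bound reduces the subsolution inequality to its value at 0.\<close>

lemma green_ge_exp:
  assumes "integrable lborel f" "\<And>s. 0 \<le> f s"
  shows "exp (- \<bar>t\<bar>) * green f 0 \<le> green f t"
proof -
  have "exp (- \<bar>t\<bar>) * green f 0 = (LINT s|lborel. exp (- \<bar>t\<bar>) * (exp (- \<bar>0 - s\<bar>) / 2 * f s))"
    unfolding green_def by (rule integral_mult_right_zero[symmetric])
  also have "\<dots> \<le> green f t"
    unfolding green_def
  proof (intro Bochner_Integration.integral_mono integrable_mult_right integrable_green_kernel assms)
    fix s :: real
    have "exp (- \<bar>t\<bar>) * exp (- \<bar>s\<bar>) \<le> exp (- \<bar>t - s\<bar>)"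
      unfolding exp_add[symmetric] by simp
    then have "exp (- \<bar>t\<bar>) * exp (- \<bar>s\<bar>) * (f s / 2) \<le> exp (- \<bar>t - s\<bar>) * (f s / 2)"
      using assms(2)[of s] by (intro mult_right_mono) auto
    then show "exp (- \<bar>t\<bar>) * (exp (- \<bar>0 - s\<bar>) / 2 * f s) \<le> exp (- \<bar>t - s\<bar>) / 2 * f s"
      by simp
  qed
  finally show ?thesis .
qed

text \<open>The kernel tends to 0 pointwise in \<open>s\<close> and is at most 1/2, so dominated
  convergence applies with majorant \<bar>f\<bar>. Allowing any sequence that leaves bounded sets
  covers both ends of the line at once.\<close>

lemma green_tendsto_zero:
  assumes "integrable lborel f" and X: "filterlim X at_infinity sequentially"
  shows "(\<lambda>n::nat. green f (X n)) \<longlonglongrightarrow> 0"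
proof -
  have "(\<lambda>n. green f (X n)) \<longlonglongrightarrow> (LINT (s::real)|lborel. 0)"
    unfolding green_def
  proof (rule integral_dominated_convergence[where w = "\<lambda>s. \<bar>f s\<bar>"])
    have "filterlim (\<lambda>n. \<bar>X n - s\<bar>) at_top sequentially" for s
    proof (rule filterlim_at_top_mono)
      show "filterlim (\<lambda>n. - \<bar>s\<bar> + \<bar>X n\<bar>) at_top sequentially"
        using filterlim_at_infinity_imp_norm_at_top[OF X]
        by (intro filterlim_tendsto_add_at_top[OF tendsto_const]) simp
    qed (intro always_eventually, auto)
    then have "(\<lambda>n. exp (- \<bar>X n - s\<bar>)) \<longlonglongrightarrow> 0" for s
      by (intro filterlim_compose[OF exp_at_bot]) (simp add: filterlim_uminus_at_bot)
    then have "(\<lambda>n. exp (- \<bar>X n - s\<bar>) / 2 * f s) \<longlonglongrightarrow> 0 / 2 * f s" for s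
      by (intro tendsto_intros) auto
    then show "AE s in lborel. (\<lambda>n. exp (- \<bar>X n - s\<bar>) / 2 * f s) \<longlonglongrightarrow> 0"
      by simp
    have "exp (- \<bar>X n - s\<bar>) / 2 * \<bar>f s\<bar> \<le> 1 * \<bar>f s\<bar>" for n s
      by (intro mult_right_mono) (auto intro: order_trans[of _ 1])
    then show "AE s in lborel. norm (exp (- \<bar>X n - s\<bar>) / 2 * f s) \<le> \<bar>f s\<bar>" for n
      by (simp add: abs_mult)
  qed (use assms in \<open>auto\<close>)
  then show ?thesis by simp
qed

text \<open>Function and point vary together, so one use of dominated convergence serves two
  purposes: constant \<open>g\<close> yields continuity of \<open>green f\<close>, and constant
  \<open>X\<close> yields the passage to the limit in the iteration.\<close>

lemma green_tendsto:
  assumes f: "integrable lborel f" and g: "\<And>n. g n \<in> borel_measurable lborel"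
    and bound: "\<And>n s. \<bar>g n s\<bar> \<le> f s" and lim: "\<And>s. (\<lambda>n::nat. g n s) \<longlonglongrightarrow> h s"
    and h: "h \<in> borel_measurable lborel" and X: "X \<longlonglongrightarrow> t"
  shows "(\<lambda>n. green (g n) (X n)) \<longlonglongrightarrow> green h t"
  unfolding green_def
proof (rule integral_dominated_convergence[where w = f])
  show "AE s in lborel. (\<lambda>n. exp (- \<bar>X n - s\<bar>) / 2 * g n s) \<longlonglongrightarrow> exp (- \<bar>t - s\<bar>) / 2 * h s"
    by (intro AE_I2 tendsto_intros lim X) auto
  have "exp (- \<bar>X n - s\<bar>) / 2 * \<bar>g n s\<bar> \<le> 1 * f s" for n s
    by (intro mult_mono bound) (auto intro: order_trans[of _ 1])
  then show "AE s in lborel. norm (exp (- \<bar>X n - s\<bar>) / 2 * g n s) \<le> f s" for n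
    by (simp add: abs_mult)
qed (use f g h in \<open>auto\<close>)

lemma continuous_on_green:
  assumes "integrable lborel f"
  shows "continuous_on UNIV (green f)"
proof (rule continuous_at_imp_continuous_on, rule ballI)
  fix t :: real
  show "isCont (green f) t"
    unfolding continuous_at_sequentially comp_def
    using green_tendsto[of "\<lambda>s. \<bar>f s\<bar>" "\<lambda>_. f" f] assms by auto
qed

section \<open>Differentiation of the Green operator\<close>

lemma set_integral_ray_DERIV:
  fixes g :: "real \<Rightarrow> real"
  assumes cont: "continuous_on UNIV g"
  shows "(\<And>t. set_integrable lborel {..t} g) \<Longrightarrow>
      ((\<lambda>t. LINT s:{..t}|lborel. g s) has_real_derivative g x) (at x)"
    and "(\<And>t. set_integrable lborel {t..} g) \<Longrightarrow>
      ((\<lambda>t. LINT s:{t<..}|lborel. g s) has_real_derivative - g x) (at x)"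
proof -
  \<comment> \<open>The ray integral is a constant plus or minus the integral over a compact
    interval starting at \<open>x - 1\<close>, to which the fundamental theorem of calculus applies.
    The splitting holds for t > x - 1, a neighbourhood of \<open>x\<close>, and this suffices
    because the derivative is local.\<close>
  have int: "set_integrable lborel {x - 1..t} g" for t
    by (intro borel_integrable_atLeastAtMost' continuous_on_subset[OF cont]) auto
  have eq: "(LINT s:{x - 1..t}|lborel. g s) = integral {x - 1..t} g" for t
    by (rule set_borel_integral_eq_integral[OF int])
  have "((\<lambda>t. integral {x - 1..t} g) has_real_derivative g x) (at x within {x - 1..x + 1})"
    by (rule integral_has_real_derivative) (auto intro: continuous_on_subset[OF cont])
  then have deriv: "((\<lambda>t. integral {x - 1..t} g) has_real_derivative g x) (at x)"
    by (simp add: at_within_Icc_at)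
  have nhd: "eventually (\<lambda>t. t \<in> {x - 1<..}) (nhds x)"
    by (intro eventually_nhds_in_open) auto
  {
    assume *: "\<And>t. set_integrable lborel {..t} g"
    have "(LINT s:{..t}|lborel. g s) = (LINT s:{..<x - 1}|lborel. g s) + integral {x - 1..t} g"
      if "t \<in> {x - 1<..}" for t
    proof -
      have "{..t} = {..<x - 1} \<union> {x - 1..t}" using that by auto
      moreover have "set_integrable lborel {..<x - 1} g"
        by (rule set_integrable_subset[OF *[of "x - 1"]]) auto
      ultimately show ?thesis
        using set_integral_Un[of "{..<x - 1}" "{x - 1..t}" lborel g] int[of t] eq[of t]
        by (auto simp: disjoint_iff)
    qed
    then have ev: "eventually (\<lambda>t. (LINT s:{..t}|lborel. g s) =
        (LINT s:{..<x - 1}|lborel. g s) + integral {x - 1..t} g) (nhds x)"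
      by (rule eventually_mono[OF nhd])
    show "((\<lambda>t. LINT s:{..t}|lborel. g s) has_real_derivative g x) (at x)"
      unfolding DERIV_cong_ev[OF refl ev refl]
      by (auto intro!: derivative_eq_intros deriv)
  next
    assume *: "\<And>t. set_integrable lborel {t..} g"
    have "(LINT s:{t<..}|lborel. g s) = (LINT s:{x - 1..}|lborel. g s) - integral {x - 1..t} g"
      if "t \<in> {x - 1<..}" for t
    proof -
      have "{x - 1..} = {x - 1..t} \<union> {t<..}" using that by auto
      moreover have "set_integrable lborel {t<..} g"
        by (rule set_integrable_subset[OF *[of t]]) auto
      ultimately show ?thesis
        using set_integral_Un[of "{x - 1..t}" "{t<..}" lborel g] int[of t] eq[of t]
        by (auto simp: disjoint_iff)
    qed
    then have ev: "eventually (\<lambda>t. (LINT s:{t<..}|lborel. g s) =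
        (LINT s:{x - 1..}|lborel. g s) - integral {x - 1..t} g) (nhds x)"
      by (rule eventually_mono[OF nhd])
    show "((\<lambda>t. LINT s:{t<..}|lborel. g s) has_real_derivative - g x) (at x)"
      unfolding DERIV_cong_ev[OF refl ev refl]
      by (auto intro!: derivative_eq_intros deriv)
  }
qed

text \<open>Splitting the kernel at s = t writes \<open>green f\<close> as the sum of the
  non-negative terms exp (-t) / 2 * A t and exp t / 2 * B t. The contributions of A' and B' cancel
  in the first derivative and add up to - f in the second. The first derivative is the difference of
  the same two terms, hence bounded in modulus by their sum; this bound later gives the decay of the
  velocity.\<close>

lemma green_second_derivative:
  assumes cont: "continuous_on UNIV f" and int: "integrable lborel f" and nonneg: "\<And>s. 0 \<le> f s"
  obtains v where "\<And>t. (green f has_real_derivative v t) (at t)"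
    and "\<And>t. (v has_real_derivative green f t - f t) (at t)"
    and "\<And>t. \<bar>v t\<bar> \<le> green f t"
proof -
  define A where "A t = (LINT s:{..t}|lborel. exp s * f s)" for t
  define B where "B t = (LINT s:{t<..}|lborel. exp (- s) * f s)" for t
  have [measurable]: "f \<in> borel_measurable borel"
    using int by auto
  \<comment> \<open>On its ray each exponential weight is largest at the endpoint \<open>t\<close>,
    so a constant multiple of \<open>f\<close> is a majorant.\<close>
  have A_int: "set_integrable lborel {..t} (\<lambda>s. exp s * f s)" for t
    unfolding set_integrable_def
  proof (rule Bochner_Integration.integrable_bound)
    show "integrable lborel (\<lambda>s. exp t * f s)" using int by simp
    show "AE s in lborel. norm (indicat_real {..t} s *\<^sub>R (exp s * f s)) \<le> norm (exp t * f s)"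
      using nonneg by (auto simp: indicator_def abs_mult intro!: mult_right_mono)
  qed measurable
  have B_int: "set_integrable lborel {t..} (\<lambda>s. exp (- s) * f s)" for t
    unfolding set_integrable_def
  proof (rule Bochner_Integration.integrable_bound)
    show "integrable lborel (\<lambda>s. exp (- t) * f s)" using int by simp
    show "AE s in lborel. norm (indicat_real {t..} s *\<^sub>R (exp (- s) * f s)) \<le> norm (exp (- t) * f s)"
      using nonneg by (auto simp: indicator_def abs_mult intro!: mult_right_mono)
  qed measurable
  \<comment> \<open>The open ray makes the two pieces a partition of the line; the closed ray above
    is what the differentiation lemma asks for.\<close>
  have B_int': "set_integrable lborel {t<..} (\<lambda>s. exp (- s) * f s)" for t
    by (rule set_integrable_subset[OF B_int[of t]]) auto
  have dA: "(A has_real_derivative exp t * f t) (at t)" for t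
    unfolding A_def using A_int
    by (intro set_integral_ray_DERIV(1)) (auto intro!: continuous_intros cont)
  have dB: "(B has_real_derivative - (exp (- t) * f t)) (at t)" for t
    unfolding B_def using B_int
    by (intro set_integral_ray_DERIV(2)) (auto intro!: continuous_intros cont)
  have "green f t = (LINT s|lborel. exp (- t) / 2 * (indicator {..t} s *\<^sub>R (exp s * f s)) +
      exp t / 2 * (indicator {t<..} s *\<^sub>R (exp (- s) * f s)))" for t
    unfolding green_def
    by (intro Bochner_Integration.integral_cong)
       (auto simp: indicator_def exp_minus exp_diff field_simps)
  also have "\<dots> t = exp (- t) / 2 * A t + exp t / 2 * B t" for t
    unfolding A_def B_def set_lebesgue_integral_def
    using A_int[of t] B_int'[of t] unfolding set_integrable_def
    by (subst Bochner_Integration.integral_add) auto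
  finally have green_eq: "green f = (\<lambda>t. exp (- t) / 2 * A t + exp t / 2 * B t)"
    by (rule ext)
  define v where "v t = - exp (- t) / 2 * A t + exp t / 2 * B t" for t
  have nn: "0 \<le> A t" "0 \<le> B t" for t
    unfolding A_def B_def set_lebesgue_integral_def
    using nonneg by (auto intro!: Bochner_Integration.integral_nonneg)
  show thesis
  proof
    show "(green f has_real_derivative v t) (at t)" for t
      unfolding green_eq v_def
      by (auto intro!: derivative_eq_intros dA dB simp: exp_minus field_simps)
    show "(v has_real_derivative green f t - f t) (at t)" for t
      unfolding green_eq v_def
      by (auto intro!: derivative_eq_intros dA dB simp: exp_minus field_simps)
    show "\<bar>v t\<bar> \<le> green f t" for t
      using nn[of t] unfolding green_eq v_def by (simp add: abs_le_iff)
  qed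
qed

section \<open>A positive fixed point by monotone iteration\<close>

lemma sublinear_green_fixed_point:
  fixes b :: "real \<Rightarrow> real"
  assumes int: "integrable lborel b" and pos: "\<And>t. 0 < b t" and \<beta>: "0 < \<beta>" "\<beta> < 1"
  obtains u where "\<And>t. 0 < u t" and "integrable lborel (\<lambda>s. b s * u s powr \<beta>)"
    and "u = green (\<lambda>s. b s * u s powr \<beta>)"
proof -
  have [measurable]: "b \<in> borel_measurable borel"
    using int by auto
  define S where "S w = green (\<lambda>s. b s * w s powr \<beta>)" for w
  have integrable_S: "integrable lborel (\<lambda>s. b s * w s powr \<beta>)"
    if [measurable]: "w \<in> borel_measurable borel" and "\<And>s. 0 \<le> w s" "\<And>s. w s \<le> c" for w c
  proof (rule Bochner_Integration.integrable_bound)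
    show "integrable lborel (\<lambda>s. b s * c powr \<beta>)"
      using int by simp
    show "AE s in lborel. norm (b s * w s powr \<beta>) \<le> norm (b s * c powr \<beta>)"
      using that pos[THEN less_imp_le] \<beta>
      by (auto simp: abs_mult intro!: mult_left_mono powr_mono2)
  qed measurable
  have S_mono: "S w t \<le> S w' t"
    if "w \<in> borel_measurable borel" "w' \<in> borel_measurable borel" "\<And>s. 0 \<le> w s"
      "\<And>s. w s \<le> w' s" "\<And>s. w' s \<le> c" for w w' c t
    unfolding S_def using that pos[THEN less_imp_le] \<beta>
    by (intro green_mono integrable_S[of _ c] mult_left_mono powr_mono2)
       (auto intro: order_trans)

  \<comment> \<open>For c > 0, \<open>S\<close> maps the constant \<open>c\<close> to at most M * c
    powr \<beta>, and maps c * exp (-\<bar>t\<bar>) to at least K * c powr \<beta> * exp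
    (-\<bar>t\<bar>). These two constants therefore fix the heights of the supersolution and of the
    subsolution.\<close>
  define M where "M = (LINT s|lborel. b s) / 2"
  define g where "g s = b s * exp (- \<bar>s\<bar>) powr \<beta>" for s
  define K where "K = green g 0"
  have g_int: "integrable lborel g"
    unfolding g_def by (rule integrable_S[of _ 1]) auto
  have g_pos: "0 < g s" for s
    using pos[of s] by (simp add: g_def)
  have "0 < K"
  proof -
    \<comment> \<open>A vanishing integral of a non-negative function forces the integrand to be 0
      almost everywhere, but here it is positive everywhere and Lebesgue measure is not
      zero.\<close>
    have "K \<noteq> 0"
    proof
      assume "K = 0"
      then have "AE s in lborel. exp (- \<bar>0 - s\<bar>) / 2 * g s = 0"
        unfolding K_def green_def
        using integrable_green_kernel[OF g_int, of 0] g_pos[THEN less_imp_le]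
        by (subst (asm) integral_nonneg_eq_0_iff_AE) auto
      then have "AE s in (lborel :: real measure). False"
        by eventually_elim (use g_pos in \<open>simp add: less_imp_neq[symmetric]\<close>)
      then show False
        by (simp add: eventually_False ae_filter_eq_bot_iff)
    qed
    moreover have "0 \<le> K"
      unfolding K_def by (intro green_nonneg g_pos[THEN less_imp_le])
    ultimately show ?thesis by simp
  qed
  \<comment> \<open>This orders the two heights, so that the subsolution lies below the
    supersolution.\<close>
  have "K \<le> M"
  proof -
    have "g s \<le> b s" for s
      unfolding g_def using mult_left_mono[OF powr_le1[of \<beta> "exp (- \<bar>s\<bar>)"], of "b s"]
        pos[of s] \<beta> by simp
    then have "(LINT s|lborel. g s) \<le> (LINT s|lborel. b s)"
      using g_int int by (intro Bochner_Integration.integral_mono)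
    then show ?thesis
      using green_le_integral[OF g_int, of 0] g_pos[THEN less_imp_le] unfolding K_def M_def by simp
  qed
  \<comment> \<open>For x > 0 this is the positive root \<open>c\<close> of x * c powr \<beta> = c;
    sublinearity \<beta> < 1 makes the exponent positive, hence \<open>e\<close> monotone.\<close>
  define e where "e x = x powr (1 / (1 - \<beta>))" for x :: real
  have e_pos: "0 < e x" if "0 < x" for x
    using that by (simp add: e_def)
  have e_eq: "x * e x powr \<beta> = e x" if "0 < x" for x
  proof -
    have "x * e x powr \<beta> = x powr (1 + \<beta> / (1 - \<beta>))"
      using that by (simp add: e_def powr_powr powr_add)
    also have "1 + \<beta> / (1 - \<beta>) = 1 / (1 - \<beta>)"
      using \<beta> by (simp add: field_simps)
    finally show ?thesis by (simp add: e_def)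
  qed
  have eKM: "e K \<le> e M"
    unfolding e_def using \<open>0 < K\<close> \<open>K \<le> M\<close> \<beta> by (intro powr_mono2) auto
  define low where "low t = e K * exp (- \<bar>t\<bar>)" for t :: real
  have [measurable]: "low \<in> borel_measurable borel"
    unfolding low_def by measurable
  have low_pos: "0 < low t" for t
    using e_pos[OF \<open>0 < K\<close>] by (simp add: low_def)
  have low_le: "low t \<le> e M" for t
    using order_trans[OF mult_left_mono[of "exp (- \<bar>t\<bar>)" 1 "e K"]] eKM e_pos[OF \<open>0 < K\<close>]
    by (simp add: low_def)
  \<comment> \<open>By homogeneity of degree \<beta>, \<open>S low 0\<close> equals K * e K powr
    \<beta>, which is \<open>e K\<close>, the value of \<open>low\<close> at 0. The bound
    \<open>green_ge_exp\<close> carries the inequality from 0 to every \<open>t\<close>.\<close>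
  have low_sub: "low t \<le> S low t" for t
  proof -
    have eq: "(\<lambda>s. b s * low s powr \<beta>) = (\<lambda>s. e K powr \<beta> * g s)"
      using e_pos[OF \<open>0 < K\<close>] by (simp add: low_def g_def powr_mult mult_ac fun_eq_iff)
    have "S low 0 = e K powr \<beta> * K"
      unfolding S_def eq K_def green_def
      by (subst integral_mult_right_zero[symmetric]) (simp add: mult_ac)
    then have "S low 0 = e K"
      using e_eq[OF \<open>0 < K\<close>] by (simp add: mult.commute)
    then show ?thesis
      using green_ge_exp[of "\<lambda>s. b s * low s powr \<beta>" t]
        integrable_S[of low "e M"] low_le low_pos[THEN less_imp_le] pos[THEN less_imp_le]
      by (simp add: low_def S_def mult.commute)
  qed
  have "0 < M" using \<open>0 < K\<close> \<open>K \<le> M\<close> by simp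
  have top_super: "S (\<lambda>_. e M) t \<le> e M" for t
  proof -
    have "S (\<lambda>_. e M) t \<le> (LINT s|lborel. b s * e M powr \<beta>) / 2"
      unfolding S_def using int pos[THEN less_imp_le] by (intro green_le_integral) auto
    also have "\<dots> = M * e M powr \<beta>"
      by (simp add: M_def)
    finally show ?thesis
      using e_eq[OF \<open>0 < M\<close>] by simp
  qed

  define w where "w n = (S ^^ n) (\<lambda>_. e M)" for n
  have w_0: "w 0 = (\<lambda>_. e M)" and w_Suc: "w (Suc n) = S (w n)" for n
    by (simp_all add: w_def)
  \<comment> \<open>The induction step sandwiches the new iterate: \<open>low\<close> is below
    \<open>S low\<close>, which is below \<open>S (w n)\<close>, which is below \<open>S\<close> of
    the constant \<open>e M\<close>, hence below \<open>e M\<close>. Measurability persists because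
    values of \<open>S\<close> are continuous.\<close>
  have w_bounds: "w n \<in> borel_measurable borel \<and> (\<forall>t. low t \<le> w n t \<and> w n t \<le> e M)" for n
  proof (induction n)
    case 0
    show ?case using low_le by (simp add: w_0)
  next
    case (Suc n)
    then have w: "w n \<in> borel_measurable borel" "\<And>t. low t \<le> w n t" "\<And>t. w n t \<le> e M"
      by auto
    have w0: "0 \<le> w n t" for t
      using low_pos[of t] w(2)[of t] by simp
    have "w (Suc n) \<in> borel_measurable borel"
      unfolding w_Suc S_def
      by (intro borel_measurable_continuous_onI continuous_on_green integrable_S[OF w(1) w0 w(3)])
    moreover have "low t \<le> w (Suc n) t" for t
      using low_sub[of t] S_mono[of low "w n" "e M" t] w low_pos[THEN less_imp_le]
      by (simp add: w_Suc)
    moreover have "w (Suc n) t \<le> e M" for t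
      using top_super[of t] S_mono[of "w n" "\<lambda>_. e M" "e M" t] w w0 by (simp add: w_Suc)
    ultimately show ?case by blast
  qed
  have w_meas [measurable]: "w n \<in> borel_measurable borel"
    and low_le_w: "low t \<le> w n t" and w_le: "w n t \<le> e M" for n t
    using w_bounds by auto
  have w_nonneg: "0 \<le> w n t" for n t
    using low_pos[of t] low_le_w[of t n] by simp
  \<comment> \<open>The first comparison is the upper bound \<open>e M\<close>; monotonicity of
    \<open>S\<close> propagates it.\<close>
  have w_dec: "w (Suc n) t \<le> w n t" for n t
  proof (induction n arbitrary: t)
    case 0
    show ?case using w_le[of 1 t] by (simp add: w_0)
  next
    case (Suc n)
    have "S (w (Suc n)) t \<le> S (w n) t"
      by (rule S_mono[where c = "e M"]) (use Suc w_nonneg w_le in auto)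
    then show ?case
      by (simp only: w_Suc)
  qed
  define u where "u t = lim (\<lambda>n. w n t)" for t
  have w_lim: "(\<lambda>n. w n t) \<longlonglongrightarrow> u t" for t
  proof -
    have "decseq (\<lambda>n. w n t)"
      by (rule decseq_SucI) (rule w_dec)
    then obtain L where "(\<lambda>n. w n t) \<longlonglongrightarrow> L"
      using decseq_convergent[of "\<lambda>n. w n t" 0] w_nonneg by metis
    then show ?thesis
      unfolding u_def by (simp add: limI)
  qed
  have u_meas [measurable]: "u \<in> borel_measurable borel"
    by (rule borel_measurable_LIMSEQ_real[OF w_lim]) auto
  \<comment> \<open>The zero function is a fixed point of \<open>S\<close> too, since 0 powr \<beta>
    = 0; the lower barrier survives the limit and excludes it.\<close>
  have u_low: "low t \<le> u t" for t
    by (rule LIMSEQ_le_const[OF w_lim]) (use low_le_w in auto)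
  have u_le: "u t \<le> e M" for t
    by (rule LIMSEQ_le_const2[OF w_lim]) (use w_le in auto)
  have u_pos: "0 < u t" for t
    using low_pos[of t] u_low[of t] by simp
  \<comment> \<open>The upper barrier supplies the integrable majorant, and positivity of
    \<open>u\<close> gives continuity of the power at the limit.\<close>
  have "(\<lambda>n. S (w n) t) \<longlonglongrightarrow> S u t" for t
    unfolding S_def
  proof (rule green_tendsto[where f = "\<lambda>s. b s * e M powr \<beta>"])
    show "\<bar>b s * w n s powr \<beta>\<bar> \<le> b s * e M powr \<beta>" for n s
      using pos[THEN less_imp_le] w_nonneg w_le \<beta>
      by (auto simp: abs_mult intro!: mult_left_mono powr_mono2)
    show "(\<lambda>n. b s * w n s powr \<beta>) \<longlonglongrightarrow> b s * u s powr \<beta>" for s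
      using u_pos[of s] by (intro tendsto_intros w_lim) auto
  qed (use int in auto)
  then have "(\<lambda>n. w (Suc n) t) \<longlonglongrightarrow> S u t" for t
    by (simp add: w_Suc)
  then have "u t = S u t" for t
    using LIMSEQ_unique[OF w_lim[THEN LIMSEQ_Suc]] by blast
  then have "u = S u" by (rule ext)
  show thesis
  proof (rule that)
    show "0 < u t" for t by (rule u_pos)
    show "integrable lborel (\<lambda>s. b s * u s powr \<beta>)"
      using u_pos[THEN less_imp_le] u_le by (rule integrable_S[OF u_meas])
    show "u = green (\<lambda>s. b s * u s powr \<beta>)"
      using \<open>u = S u\<close> unfolding S_def .
  qed
qed

section \<open>From the scalar fixed point to the homoclinic orbit\<close>

theorem theorem1p2:
  fixes \<alpha> :: real and a :: "real \<Rightarrow> real"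
  assumes "1 < \<alpha>" and "\<alpha> < 2"
    and "continuous_on UNIV a" and "\<And>t. 0 < a t"
    and "integrable lborel a" and "integrable lborel (\<lambda>t. (a t)\<^sup>2)"
  shows "\<exists>q :: real \<Rightarrow> real ^ 'n.
      homoclinic_orbit (potential \<alpha> a) q \<and> (\<exists>t. q t \<noteq> 0) \<and>
      (q \<longlongrightarrow> 0) at_top \<and> (q \<longlongrightarrow> 0) at_bot \<and>
      ((\<lambda>t. vector_derivative q (at t)) \<longlongrightarrow> 0) at_top \<and>
      ((\<lambda>t. vector_derivative q (at t)) \<longlongrightarrow> 0) at_bot"
proof -
  \<comment> \<open>The exponent \<alpha> - 1 lies strictly between 0 and 1 exactly because 1 <
    \<alpha> < 2.\<close>
  obtain u where u_pos: "\<And>t. 0 < u t"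
    and int: "integrable lborel (\<lambda>s. \<alpha> * a s * u s powr (\<alpha> - 1))"
    and fix_u: "u = green (\<lambda>s. \<alpha> * a s * u s powr (\<alpha> - 1))"
    using sublinear_green_fixed_point[of "\<lambda>s. \<alpha> * a s" "\<alpha> - 1"] assms by auto
  define f where "f s = \<alpha> * a s * u s powr (\<alpha> - 1)" for s
  have f_int: "integrable lborel f" and u_eq: "green f = u"
    using int fix_u unfolding f_def by simp_all
  have u_cont: "continuous_on UNIV u"
    using continuous_on_green[OF f_int] by (simp add: u_eq)
  have f_cont: "continuous_on UNIV f"
    unfolding f_def using u_pos
    by (intro continuous_intros u_cont assms) (auto simp: less_imp_neq[symmetric])
  have f_nonneg: "0 \<le> f s" for s
    using assms(1) assms(4)[of s] by (simp add: f_def)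
  obtain v where du: "\<And>t. (u has_real_derivative v t) (at t)"
    and dv: "\<And>t. (v has_real_derivative u t - f t) (at t)" and v_le: "\<And>t. \<bar>v t\<bar> \<le> u t"
    using green_second_derivative[OF f_cont f_int f_nonneg] unfolding u_eq by blast
  have u_top: "(u \<longlongrightarrow> 0) at_top"
    by (intro tendsto_at_topI_sequentially green_tendsto_zero[OF f_int, unfolded u_eq]
        filterlim_mono[OF _ at_top_le_at_infinity order_refl])
  have u_bot: "(u \<longlongrightarrow> 0) at_bot"
    by (intro tendsto_at_botI_sequentially green_tendsto_zero[OF f_int, unfolded u_eq]
        filterlim_mono[OF _ at_bot_le_at_infinity order_refl])
  \<comment> \<open>The pointwise bound of \<bar>v\<bar> by \<open>u\<close> transfers the decay of
    the orbit to its velocity.\<close>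
  have v_lim: "(v \<longlongrightarrow> 0) F" if "(u \<longlongrightarrow> 0) F" for F
    using that by (rule Lim_null_comparison[rotated]) (simp add: v_le)

  \<comment> \<open>Any unit vector would do; \<open>undefined\<close> merely picks some coordinate
    of the non-empty index type.\<close>
  define e :: "real ^ 'n" where "e = axis undefined 1"
  have e: "norm e = 1" by (simp add: e_def)
  define q where "q t = u t *\<^sub>R e" for t
  have dq: "(q has_vector_derivative v t *\<^sub>R e) (at t)" for t
    unfolding q_def using has_vector_derivative_scaleR[OF du has_vector_derivative_const[of e]]
    by simp
  have vq: "(\<lambda>t. vector_derivative q (at t)) = (\<lambda>t. v t *\<^sub>R e)"
    using dq vector_derivative_at by blast
  have dvq: "((\<lambda>t. v t *\<^sub>R e) has_vector_derivative (u t - f t) *\<^sub>R e) (at t)" for t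
    using has_vector_derivative_scaleR[OF dv has_vector_derivative_const[of e]] by simp
  have v_cont: "continuous_on UNIV v"
    using dv by (intro DERIV_continuous_on) auto
  have "hamiltonian_solution (potential \<alpha> a) q"
    unfolding hamiltonian_solution_def vq
  proof (intro conjI allI exI)
    show "q C1_differentiable_on UNIV"
      unfolding C1_differentiable_on_def using dq
      by (intro exI[of _ "\<lambda>t. v t *\<^sub>R e"]) (auto intro!: continuous_intros v_cont)
    show "(\<lambda>t. v t *\<^sub>R e) C1_differentiable_on UNIV"
      unfolding C1_differentiable_on_def using dvq
      by (intro exI[of _ "\<lambda>t. (u t - f t) *\<^sub>R e"]) (auto intro!: continuous_intros u_cont f_cont)
    fix t
    show "GDERIV (potential \<alpha> a t) (q t) :> - q t + (\<alpha> * a t * norm (q t) powr (\<alpha> - 2)) *\<^sub>R q t"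
      by (rule GDERIV_potential[OF assms(1)])
    \<comment> \<open>Since \<open>e\<close> has norm 1 and \<open>u\<close> is positive,
      \<open>norm (q t)\<close> is \<open>u t\<close>. The identity then turns the nonlinear part of
      the gradient into \<open>f t *\<^sub>R e\<close>, which cancels the source term in v' = u -
      f.\<close>
    have "u t powr (\<alpha> - 1) = u t powr (\<alpha> - 2) * u t"
      using u_pos[of t] by (simp add: powr_mult_base mult.commute)
    then show "vector_derivative (\<lambda>s. v s *\<^sub>R e) (at t) +
        (- q t + (\<alpha> * a t * norm (q t) powr (\<alpha> - 2)) *\<^sub>R q t) = 0"
      using u_pos[of t]
      by (simp add: vector_derivative_at[OF dvq] q_def e f_def algebra_simps)
  qed
  moreover
  have lim_e: "((\<lambda>t. h t *\<^sub>R e) \<longlongrightarrow> 0) F" if "(h \<longlongrightarrow> 0) F" for h :: "real \<Rightarrow> real" and F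
    using tendsto_scaleR[OF that tendsto_const[of e]] by simp
  moreover have "q t \<noteq> 0" for t
    using u_pos[of t] e by (auto simp: q_def)
  ultimately show ?thesis
    unfolding homoclinic_orbit_def
    using lim_e[OF u_top, folded q_def] lim_e[OF u_bot, folded q_def]
      lim_e[OF v_lim[OF u_top]] lim_e[OF v_lim[OF u_bot]]
    by (intro exI[of _ q]) (simp add: vq)
qed

end
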